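(* Let $\mathbb{K}$ be a field and let $(\mathcal{O}, d^{\mathcal{O}})$ be a free pointed multiplicative symmetric differential graded operad ($\Sigma$-dg operad) over $\mathbb{K}$, equipped with its cosimplicial structure, whose multiplication $\mu\in(\mathcal{O}(2))_0$ and base point $1_0\in(\mathcal{O}(0))_0$ satisfy $\mu\circ_1 1_0 = 1_{\mathcal{O}} = \mu\circ_2 1_0$. Let $\odot$, $\partial$ and $\delta$ be the product, boundary operator and coboundary operator on $\mathcal{O}$ defined in the context. Then: (a) the pair $((\mathcal{O}, d^{\mathcal{O}}), \odot)$ is a chain complex algebra; (b) the triple $((\mathcal{O}, d^{\mathcal{O}}), \partial, \odot)$ is a bicomplex algebra; (c) the triple $((\mathcal{O}, d^{\mathcal{O}}), \delta, \odot)$ is a bicomplex algebra.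
   Context: A $\Sigma$-dg operad $(\mathcal{O},d^{\mathcal{O}})$ over $\mathbb{K}$ is a symmetric operad in non-negatively graded chain complexes of $\mathbb{K}$-vector spaces: for each $n\ge 0$ a graded space $\mathcal{O}(n)=\bigoplus_{r\ge 0}(\mathcal{O}(n))_r$ with a right action of the symmetric group $\Sigma_n$ and a differential $d^{\mathcal{O}}:(\mathcal{O}(n))_r\to(\mathcal{O}(n))_{r-1}$, a unit $1_{\mathcal{O}}\in(\mathcal{O}(1))_0$ with $d^{\mathcal{O}}(1_{\mathcal{O}})=0$, and partial compositions $\circ_i:(\mathcal{O}(n))_r\otimes(\mathcal{O}(m))_l\to(\mathcal{O}(n+m-1))_{r+l}$ ($1\le i\le n$) satisfying the usual unit and equivariance axioms, the associativity axioms $(x\circ_i y)\circ_{i+j-1}z=x\circ_i(y\circ_j z)$ and (for $1\le i<k\le n$, $x$ of arity $n$, $y$ of arity $m$) $(x\circ_i y)\circ_{k+m-1}z=(-1)^{|y||z|}(x\circ_k z)\circ_i y$, where $|\cdot|$ is the internal degree $r$, and $d^{\mathcal{O}}(x\circ_i y)=d^{\mathcal{O}}(x)\circ_i y+(-1)^{|x|}x\circ_i d^{\mathcal{O}}(y)$, $d^{\mathcal{O}}(x\cdot\sigma)=d^{\mathcal{O}}(x)\cdot\sigma$. Multiplicative: there is $\mu\in(\mathcal{O}(2))_0$ with $\mu\circ_1\mu=\mu\circ_2\mu$ and $d^{\mathcal{O}}(\mu)=0$. Pointed: there is an injective degree-zero chain map $\eta:\mathbb{K}\to\mathcal{O}(0)$;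 the base point is $1_0=\eta(1_{\mathbb{K}})$, and $d^{\mathcal{O}}(1_0)=0$. "Free" means that $\mathcal{O}$ comes with a collection of generators $\{B^r_n\}_{n,r\geq 0}$ on which the structure maps are defined and then extended linearly; over a field, every operad of vector spaces is regarded as freely generated in this sense by choosing a basis $B_n^r$ of each $(\mathcal{O}(n))_r$. Cosimplicial structure: codegeneracies $s_i^{n-1}:\mathcal{O}(n)\to\mathcal{O}(n-1)$, $s_i^{n-1}(x)=x\circ_i 1_0$ for $1\le i\le n$; cofaces $D_i^{n+1}:\mathcal{O}(n)\to\mathcal{O}(n+1)$ with $D_0^{n+1}(x)=\mu\circ_2 x$, $D_i^{n+1}(x)=x\circ_i\mu$ for $1\le i\le n$, $D_{n+1}^{n+1}(x)=\mu\circ_1 x$. Operators: $\partial_n=\sum_{i=1}^n(-1)^i s_i^{n-1}:(\mathcal{O}(n))_r\to(\mathcal{O}(n-1))_r$ and $\delta_n=\sum_{i=0}^{n+1}(-1)^iD_i^{n+1}:(\mathcal{O}(n))_r\to(\mathcal{O}(n+1))_r$. Product: for $x\in(\mathcal{O}(p))_u$, $y\in(\mathcal{O}(q))_v$, $x\odot y=\mu(x,y)=(\mu\circ_1 x)\circ_{p+1}y\in(\mathcal{O}(p+q))_{u+v}$. A chain complex algebra here is a (unital, associative) algebra for which $d^{\mathcal{O}}$ is a square-zero derivation: $d^{\mathcal{O}}(x\odot y)=d^{\mathcal{O}}(x)\odot y+(-1)^{|x|}x\odot d^{\mathcal{O}}(y)$. A bicomplex algebra (with respect to $d^{\mathcal{O}}$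 and a second operator $\theta\in\{\partial,\delta\}$) is such an algebra where moreover $\theta^2=0$, $\theta$ commutes with $d^{\mathcal{O}}$, and $\theta$ is a derivation for the arity grading: $\theta(x\odot y)=\theta(x)\odot y+(-1)^p x\odot\theta(y)$ for $x\in\mathcal{O}(p)$. *)

theory Defs
  imports Complex_Main "HOL-Combinatorics.Permutations"
begin

text \<open>
  A (bi)graded vector space is a family of subspaces \<open>A n r\<close> (arity \<open>n\<close>, internal degree \<open>r\<close>) of
  an ambient vector space, which only serves to give all components a common type; no relation
  between different components is assumed, and every family of vector spaces embeds in its direct
  sum.  All structure maps carry the arities and degrees of their arguments as explicit indices and
  are constrained on the components only.  They are thus given on homogeneous elements, as are all
  identities; the extension to sums of homogeneous elements is by linearity.
\<close>

definition linear_map_on ::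
  "('k \<Rightarrow> 'a::ab_group_add \<Rightarrow> 'a) \<Rightarrow> 'a set \<Rightarrow> 'a set \<Rightarrow> ('a \<Rightarrow> 'a) \<Rightarrow> bool" where
  "linear_map_on scale V W f \<longleftrightarrow>
     (\<forall>x\<in>V. f x \<in> W) \<and>
     (\<forall>x\<in>V. \<forall>y\<in>V. f (x + y) = f x + f y) \<and>
     (\<forall>c. \<forall>x\<in>V. f (scale c x) = scale c (f x))"

definition bilinear_map_on ::
  "('k \<Rightarrow> 'a::ab_group_add \<Rightarrow> 'a) \<Rightarrow> 'a set \<Rightarrow> 'a set \<Rightarrow> 'a set \<Rightarrow> ('a \<Rightarrow> 'a \<Rightarrow> 'a) \<Rightarrow> bool" where
  "bilinear_map_on scale V V' W f \<longleftrightarrow>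
     (\<forall>y\<in>V'. linear_map_on scale V W (\<lambda>x. f x y)) \<and>
     (\<forall>x\<in>V. linear_map_on scale V' W (f x))"

text \<open>
  The differential lowers the degree \<open>r\<close> by one.  Since \<open>0 - 1 = 0\<close> in \<^typ>\<open>nat\<close>, the vanishing of
  the differential in degree \<open>0\<close> is a separate axiom; terms containing such a differential are zero
  wherever \<open>r - 1\<close> occurs with \<open>r = 0\<close> below.
\<close>

locale chain_complexes = vector_space scale
  for scale :: "'k::field \<Rightarrow> 'a::ab_group_add \<Rightarrow> 'a" (infixr \<open>*s\<close> 75) +
  fixes A :: "nat \<Rightarrow> nat \<Rightarrow> 'a set"
    and d :: "nat \<Rightarrow> nat \<Rightarrow> 'a \<Rightarrow> 'a"
  assumes subspace_component: "subspace (A n r)"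
    and d_linear: "linear_map_on scale (A n r) (A n (r - 1)) (d n r)"
    and d_degree_0: "x \<in> A n 0 \<Longrightarrow> d n 0 x = 0"
    and d_d: "x \<in> A n r \<Longrightarrow> d n (r - 1) (d n r x) = 0"

text \<open>
  The permutations in the equivariance axioms.  The group \<open>\<Sigma>\<^sub>n\<close> consists of the permutations of
  \<open>{1..n}\<close> with product \<open>\<circ>\<close>, and a right action on operations is thought of as
  \<open>(x \<cdot> \<sigma>)(v\<^sub>1, \<dots>, v\<^sub>n) = x(v\<^bsub>\<sigma>\<inverse>(1)\<^esub>, \<dots>, v\<^bsub>\<sigma>\<inverse>(n)\<^esub>)\<close>.

  \<open>inner_perm m i \<tau>\<close> lets \<open>\<tau> \<in> \<Sigma>\<^sub>m\<close> act on the block \<open>{i..i+m-1}\<close>.  \<open>outer_perm n m i \<sigma>\<close> replaces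
  the point \<open>i\<close> of the domain of \<open>\<sigma> \<in> \<Sigma>\<^sub>n\<close> and its image \<open>\<sigma> i\<close> by blocks of \<open>m\<close> points, mapped onto
  each other in order; \<open>inflate m i j\<close> is the new position of a point \<open>j \<noteq> i\<close> once \<open>i\<close> has been
  replaced by such a block.
\<close>

definition inner_perm :: "nat \<Rightarrow> nat \<Rightarrow> (nat \<Rightarrow> nat) \<Rightarrow> nat \<Rightarrow> nat" where
  "inner_perm m i \<tau> k = (if i \<le> k \<and> k < i + m then \<tau> (k + 1 - i) + i - 1 else k)"

definition inflate :: "nat \<Rightarrow> nat \<Rightarrow> nat \<Rightarrow> nat" where
  "inflate m i j = (if j < i then j else j + m - 1)"

definition outer_perm :: "nat \<Rightarrow> nat \<Rightarrow> nat \<Rightarrow> (nat \<Rightarrow> nat) \<Rightarrow> nat \<Rightarrow> nat" where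
  "outer_perm n m i \<sigma> k =
     (if k < 1 \<or> n + m - 1 < k then k
      else if k < i then inflate m (\<sigma> i) (\<sigma> k)
      else if k < i + m then \<sigma> i + (k - i)
      else inflate m (\<sigma> i) (\<sigma> (k + 1 - m)))"

text \<open>\<open>circ n r m l i x y\<close> is \<open>x \<circ>\<^sub>i y\<close> for \<open>x \<in> Op n r\<close> and \<open>y \<in> Op m l\<close>.\<close>

locale sigma_dg_operad = chain_complexes scale Op d
  for scale :: "'k::field \<Rightarrow> 'a::ab_group_add \<Rightarrow> 'a" (infixr \<open>*s\<close> 75)
    and Op :: "nat \<Rightarrow> nat \<Rightarrow> 'a set"
    and d :: "nat \<Rightarrow> nat \<Rightarrow> 'a \<Rightarrow> 'a" +
  fixes act :: "nat \<Rightarrow> nat \<Rightarrow> 'a \<Rightarrow> (nat \<Rightarrow> nat) \<Rightarrow> 'a"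
    and one :: 'a
    and circ :: "nat \<Rightarrow> nat \<Rightarrow> nat \<Rightarrow> nat \<Rightarrow> nat \<Rightarrow> 'a \<Rightarrow> 'a \<Rightarrow> 'a"
  assumes act_linear: "\<sigma> permutes {1..n} \<Longrightarrow>
        linear_map_on scale (Op n r) (Op n r) (\<lambda>x. act n r x \<sigma>)"
    and act_id: "x \<in> Op n r \<Longrightarrow> act n r x id = x"
    and act_comp: "\<lbrakk>x \<in> Op n r; \<sigma> permutes {1..n}; \<tau> permutes {1..n}\<rbrakk> \<Longrightarrow>
        act n r (act n r x \<sigma>) \<tau> = act n r x (\<sigma> \<circ> \<tau>)"
    and d_act: "\<lbrakk>x \<in> Op n r; \<sigma> permutes {1..n}\<rbrakk> \<Longrightarrow>
        d n r (act n r x \<sigma>) = act n (r - 1) (d n r x) \<sigma>"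
    and one_in: "one \<in> Op 1 0"
    and d_one: "d 1 0 one = 0"
    and circ_bilinear: "\<lbrakk>1 \<le> i; i \<le> n\<rbrakk> \<Longrightarrow>
        bilinear_map_on scale (Op n r) (Op m l) (Op (n + m - 1) (r + l)) (circ n r m l i)"
    and one_circ: "x \<in> Op n r \<Longrightarrow> circ 1 0 n r 1 one x = x"
    and circ_one: "\<lbrakk>x \<in> Op n r; 1 \<le> i; i \<le> n\<rbrakk> \<Longrightarrow> circ n r 1 0 i x one = x"
    and act_circ: "\<lbrakk>x \<in> Op n r; y \<in> Op m l; 1 \<le> i; i \<le> n; \<sigma> permutes {1..n}\<rbrakk> \<Longrightarrow>
        circ n r m l i (act n r x \<sigma>) y =
        act (n + m - 1) (r + l) (circ n r m l (\<sigma> i) x y) (outer_perm n m i \<sigma>)"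
    and circ_act: "\<lbrakk>x \<in> Op n r; y \<in> Op m l; 1 \<le> i; i \<le> n; \<tau> permutes {1..m}\<rbrakk> \<Longrightarrow>
        circ n r m l i x (act m l y \<tau>) =
        act (n + m - 1) (r + l) (circ n r m l i x y) (inner_perm m i \<tau>)"
    and circ_assoc_sequential:
      "\<lbrakk>x \<in> Op n r; y \<in> Op m l; z \<in> Op p t; 1 \<le> i; i \<le> n; 1 \<le> j; j \<le> m\<rbrakk> \<Longrightarrow>
        circ (n + m - 1) (r + l) p t (i + j - 1) (circ n r m l i x y) z =
        circ n r (m + p - 1) (l + t) i x (circ m l p t j y z)"
    and circ_assoc_parallel:
      "\<lbrakk>x \<in> Op n r; y \<in> Op m l; z \<in> Op p t; 1 \<le> i; i < k; k \<le> n\<rbrakk> \<Longrightarrow>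
        circ (n + m - 1) (r + l) p t (k + m - 1) (circ n r m l i x y) z =
        (-1) ^ (l * t) *s circ (n + p - 1) (r + t) m l i (circ n r p t k x z) y"
    and d_circ: "\<lbrakk>x \<in> Op n r; y \<in> Op m l; 1 \<le> i; i \<le> n\<rbrakk> \<Longrightarrow>
        d (n + m - 1) (r + l) (circ n r m l i x y) =
        circ n (r - 1) m l i (d n r x) y + (-1) ^ r *s circ n r m (l - 1) i x (d m l y)"

locale free_sigma_dg_operad = sigma_dg_operad scale Op d act one circ
  for scale :: "'k::field \<Rightarrow> 'a::ab_group_add \<Rightarrow> 'a" (infixr \<open>*s\<close> 75)
    and Op d act one circ +
  fixes B :: "nat \<Rightarrow> nat \<Rightarrow> 'a set"
  assumes independent_generators: "independent (B n r)"
    and span_generators: "span (B n r) = Op n r"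

locale free_pointed_multiplicative_sigma_dg_operad =
  free_sigma_dg_operad scale Op d act one circ B
  for scale :: "'k::field \<Rightarrow> 'a::ab_group_add \<Rightarrow> 'a" (infixr \<open>*s\<close> 75)
    and Op d act one circ B +
  fixes \<mu> :: 'a and \<eta> :: "'k \<Rightarrow> 'a"
  assumes mu_in: "\<mu> \<in> Op 2 0"
    and mu_assoc: "circ 2 0 2 0 1 \<mu> \<mu> = circ 2 0 2 0 2 \<mu> \<mu>"
    and d_mu: "d 2 0 \<mu> = 0"
    and eta_linear: "Vector_Spaces.linear (*) scale \<eta>"
    and eta_in: "\<eta> c \<in> Op 0 0"
    and eta_inj: "inj \<eta>"
    and d_eta: "d 0 0 (\<eta> c) = 0"

text \<open>
  Cosimplicial structure, (co)boundary and product, for a partial composition \<open>circ\<close>, a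
  multiplication \<open>\<mu>\<close> and a base point \<open>e\<close>.  The index pair \<open>n r\<close> is the arity and degree of the
  argument, so \<open>codegeneracy circ e n r i\<close> is \<open>s\<^sub>i\<close> with target arity \<open>n - 1\<close> and
  \<open>coface circ \<mu> n r i\<close> is \<open>D\<^sub>i\<close> with target arity \<open>n + 1\<close>.
\<close>

type_synonym 'a partial_composition = "nat \<Rightarrow> nat \<Rightarrow> nat \<Rightarrow> nat \<Rightarrow> nat \<Rightarrow> 'a \<Rightarrow> 'a \<Rightarrow> 'a"

definition codegeneracy :: "'a partial_composition \<Rightarrow> 'a \<Rightarrow> nat \<Rightarrow> nat \<Rightarrow> nat \<Rightarrow> 'a \<Rightarrow> 'a" where
  "codegeneracy circ e n r i x = circ n r 0 0 i x e"

definition coface :: "'a partial_composition \<Rightarrow> 'a \<Rightarrow> nat \<Rightarrow> nat \<Rightarrow> nat \<Rightarrow> 'a \<Rightarrow> 'a" where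
  "coface circ \<mu> n r i x =
     (if i = 0 then circ 2 0 n r 2 \<mu> x
      else if i = n + 1 then circ 2 0 n r 1 \<mu> x
      else circ n r 2 0 i x \<mu>)"

definition boundary ::
  "('k::field \<Rightarrow> 'a::ab_group_add \<Rightarrow> 'a) \<Rightarrow> 'a partial_composition \<Rightarrow> 'a \<Rightarrow> nat \<Rightarrow> nat \<Rightarrow> 'a \<Rightarrow> 'a" where
  "boundary scale circ e n r x = (\<Sum>i = 1..n. scale ((-1) ^ i) (codegeneracy circ e n r i x))"

definition coboundary ::
  "('k::field \<Rightarrow> 'a::ab_group_add \<Rightarrow> 'a) \<Rightarrow> 'a partial_composition \<Rightarrow> 'a \<Rightarrow> nat \<Rightarrow> nat \<Rightarrow> 'a \<Rightarrow> 'a" where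
  "coboundary scale circ \<mu> n r x = (\<Sum>i = 0..n + 1. scale ((-1) ^ i) (coface circ \<mu> n r i x))"

definition odot ::
  "'a partial_composition \<Rightarrow> 'a \<Rightarrow> nat \<Rightarrow> nat \<Rightarrow> nat \<Rightarrow> nat \<Rightarrow> 'a \<Rightarrow> 'a \<Rightarrow> 'a" where
  "odot circ \<mu> p u q v x y = circ (p + 1) u q v (p + 1) (circ 2 0 p u 1 \<mu> x) y"

text \<open>\<open>prod p u q v x y\<close> is the product of \<open>x \<in> A p u\<close> and \<open>y \<in> A q v\<close>, and \<open>e\<close> is the unit.\<close>

locale chain_complex_algebra = chain_complexes scale A d
  for scale :: "'k::field \<Rightarrow> 'a::ab_group_add \<Rightarrow> 'a" (infixr \<open>*s\<close> 75)
    and A :: "nat \<Rightarrow> nat \<Rightarrow> 'a set"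
    and d :: "nat \<Rightarrow> nat \<Rightarrow> 'a \<Rightarrow> 'a" +
  fixes prod :: "nat \<Rightarrow> nat \<Rightarrow> nat \<Rightarrow> nat \<Rightarrow> 'a \<Rightarrow> 'a \<Rightarrow> 'a"
    and e :: 'a
  assumes prod_bilinear:
      "bilinear_map_on scale (A p u) (A q v) (A (p + q) (u + v)) (prod p u q v)"
    and prod_assoc: "\<lbrakk>x \<in> A p u; y \<in> A q v; z \<in> A s w\<rbrakk> \<Longrightarrow>
        prod (p + q) (u + v) s w (prod p u q v x y) z =
        prod p u (q + s) (v + w) x (prod q v s w y z)"
    and unit_in: "e \<in> A 0 0"
    and unit_left: "x \<in> A p u \<Longrightarrow> prod 0 0 p u e x = x"
    and unit_right: "x \<in> A p u \<Longrightarrow> prod p u 0 0 x e = x"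
    and d_derivation: "\<lbrakk>x \<in> A p u; y \<in> A q v\<rbrakk> \<Longrightarrow>
        d (p + q) (u + v) (prod p u q v x y) =
        prod p (u - 1) q v (d p u x) y + (-1) ^ u *s prod p u q (v - 1) x (d q v y)"

text \<open>
  The second operator \<open>\<theta>\<close> changes the arity by \<open>\<epsilon> = -1\<close> (boundary) or \<open>\<epsilon> = 1\<close> (coboundary).
  Components of negative arity are zero; so for \<open>\<epsilon> = -1\<close> the operator vanishes on arity \<open>0\<close>, and
  the value of \<^term>\<open>nat\<close> at a negative argument never matters.
\<close>

definition int_component :: "(nat \<Rightarrow> nat \<Rightarrow> 'a::zero set) \<Rightarrow> int \<Rightarrow> nat \<Rightarrow> 'a set" where
  "int_component A k r = (if k < 0 then {0} else A (nat k) r)"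

locale bicomplex_algebra = chain_complex_algebra scale A d prod e
  for scale :: "'k::field \<Rightarrow> 'a::ab_group_add \<Rightarrow> 'a" (infixr \<open>*s\<close> 75)
    and A :: "nat \<Rightarrow> nat \<Rightarrow> 'a set"
    and d :: "nat \<Rightarrow> nat \<Rightarrow> 'a \<Rightarrow> 'a"
    and prod :: "nat \<Rightarrow> nat \<Rightarrow> nat \<Rightarrow> nat \<Rightarrow> 'a \<Rightarrow> 'a \<Rightarrow> 'a"
    and e :: 'a +
  fixes \<epsilon> :: int
    and \<theta> :: "nat \<Rightarrow> nat \<Rightarrow> 'a \<Rightarrow> 'a"
  assumes arity_shift: "\<epsilon> = -1 \<or> \<epsilon> = 1"
    and theta_linear: "linear_map_on scale (A n r) (int_component A (int n + \<epsilon>) r) (\<theta> n r)"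
    and theta_theta: "x \<in> A n r \<Longrightarrow> \<theta> (nat (int n + \<epsilon>)) r (\<theta> n r x) = 0"
    and theta_d: "x \<in> A n r \<Longrightarrow> \<theta> n (r - 1) (d n r x) = d (nat (int n + \<epsilon>)) r (\<theta> n r x)"
    and theta_derivation: "\<lbrakk>x \<in> A p u; y \<in> A q v\<rbrakk> \<Longrightarrow>
        \<theta> (p + q) (u + v) (prod p u q v x y) =
        prod (nat (int p + \<epsilon>)) u q v (\<theta> p u x) y +
        (-1) ^ p *s prod p u (nat (int q + \<epsilon>)) v x (\<theta> q v y)"

end

theory Submission
  imports Defs
begin

text \<open>
  Since \<open>\<mu>\<close>, \<open>1\<^sub>0\<close> and \<open>1\<^sub>\<O>\<close> are cycles of degree \<open>0\<close>, inserting them produces no signs.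
  Hence insertion of \<open>z\<close> of degree \<open>0\<close> commutes with the product:
  \<open>(x \<circ>\<^sub>i z) \<odot> y = (x \<odot> y) \<circ>\<^sub>i z\<close> and \<open>x \<odot> (y \<circ>\<^sub>j z) = (x \<odot> y) \<circ>\<^bsub>p+j\<^esub> z\<close>.
  With \<open>z = 1\<^sub>0\<close> this is the derivation property of \<open>\<partial>\<close>.  With \<open>z = \<mu>\<close> it covers the inner cofaces;
  the outer ones are \<open>D\<^sub>0 x = 1\<^sub>\<O> \<odot> x\<close> and \<open>D\<^bsub>n+1\<^esub> x = x \<odot> 1\<^sub>\<O>\<close>, and in
  \<open>\<delta> x \<odot> y + (-1)\<^sup>p x \<odot> \<delta> y\<close> the two extra terms \<open>\<plusminus> x \<odot> 1\<^sub>\<O> \<odot> y\<close> cancel.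
\<close>

section \<open>Linear maps on subspaces and alternating double sums\<close>

context vector_space
begin

lemma linear_map_on_zero:
  assumes "linear_map_on scale V W f" "subspace V"
  shows "f 0 = 0"
proof -
  have "0 \<in> V"
    using assms(2) by (rule subspace_0)
  then have "f (scale 0 0) = scale 0 (f 0)"
    using assms(1) unfolding linear_map_on_def by blast
  then show ?thesis
    by simp
qed

lemma linear_map_on_sum:
  assumes f: "linear_map_on scale V W f" and V: "subspace V"
    and v: "\<And>i. i \<in> I \<Longrightarrow> v i \<in> V"
  shows "f (\<Sum>i\<in>I. scale (c i) (v i)) = (\<Sum>i\<in>I. scale (c i) (f (v i)))"
  using v
proof (induction I rule: infinite_finite_induct)
  case (insert i I)
  then have "v i \<in> V" "(\<Sum>i\<in>I. scale (c i) (v i)) \<in> V"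
    using V by (auto intro: subspace_sum subspace_scale)
  with insert f show ?case
    using V by (simp add: linear_map_on_def subspace_scale)
qed (auto simp: linear_map_on_zero[OF f V])

lemma linear_map_on_sum_maps:
  assumes f: "\<And>i. i \<in> I \<Longrightarrow> linear_map_on scale V W (f i)" and W: "subspace W"
  shows "linear_map_on scale V W (\<lambda>x. \<Sum>i\<in>I. scale (c i) (f i x))"
  unfolding linear_map_on_def
proof (intro conjI ballI allI)
  show "(\<Sum>i\<in>I. scale (c i) (f i x)) \<in> W" if "x \<in> V" for x
    using f that W by (intro subspace_sum subspace_scale) (auto simp: linear_map_on_def)
  show "(\<Sum>i\<in>I. scale (c i) (f i (x + y))) =
      (\<Sum>i\<in>I. scale (c i) (f i x)) + (\<Sum>i\<in>I. scale (c i) (f i y))" if "x \<in> V" "y \<in> V" for x y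
    unfolding sum.distrib[symmetric]
    using f that by (intro sum.cong) (auto simp: linear_map_on_def scale_right_distrib)
  show "(\<Sum>i\<in>I. scale (c i) (f i (scale a x))) = scale a (\<Sum>i\<in>I. scale (c i) (f i x))"
    if "x \<in> V" for a x
    unfolding scale_sum_right
    using f that by (intro sum.cong) (auto simp: linear_map_on_def mult.commute)
qed

text \<open>The index square splits into \<open>i < j\<close> and \<open>j \<le> i\<close>. The map
  \<open>(i, j) \<mapsto> (j - 1, i)\<close> carries the first half bijectively onto the second,
  preserves \<open>F\<close>, and lowers \<open>i + j\<close> by one, so the terms cancel in pairs.
  This serves both \<open>\<partial>\<partial> = 0\<close> and
  \<open>\<delta>\<delta> = 0\<close>.\<close>

lemma alternating_double_sum_eq_0:
  assumes F: "\<And>i j. \<lbrakk>i < j; j \<le> Suc N\<rbrakk> \<Longrightarrow> F i j = F (j - 1) i"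
  shows "(\<Sum>i\<le>N. \<Sum>j\<le>Suc N. scale ((-1) ^ (i + j)) (F i j)) = 0"
proof -
  define g where "g = (\<lambda>(i, j). scale ((-1) ^ (i + j)) (F i j))"
  define U where "U = {(i, j). i < j \<and> j \<le> Suc N}"
  define L where "L = {(i, j). j \<le> i \<and> i \<le> N}"
  have fin: "finite U" "finite L"
    by (rule finite_subset[of _ "{..Suc N} \<times> {..Suc N}"]; auto simp: U_def L_def)+
  have "(\<Sum>i\<le>N. \<Sum>j\<le>Suc N. scale ((-1) ^ (i + j)) (F i j)) = sum g ({..N} \<times> {..Suc N})"
    by (simp add: sum.cartesian_product g_def del: sum.atMost_Suc)
  also have "{..N} \<times> {..Suc N} = U \<union> L"
    by (auto simp: U_def L_def)
  also have "sum g (U \<union> L) = sum g U + sum g L"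
    using fin by (intro sum.union_disjoint) (auto simp: U_def L_def)
  also have "sum g U = (\<Sum>p\<in>L. - g p)"
  proof (rule sum.reindex_bij_witness[of _ "\<lambda>(i, j). (j, Suc i)" "\<lambda>(i, j). (j - 1, i)"])
    fix p assume "p \<in> U"
    \<comment> \<open>In \<open>U\<close> the second index is positive; written as a successor, it
      makes \<open>j - 1\<close> exact and the change of sign visible.\<close>
    then obtain i j where p: "p = (i, Suc j)" "i \<le> j" "j \<le> N"
      by (cases p, case_tac b) (auto simp: U_def)
    then show "- g (case p of (i, j) \<Rightarrow> (j - 1, i)) = g p"
      using F[of i "Suc j"] by (simp add: g_def add.commute)
  qed (auto simp: U_def L_def)
  finally show ?thesis
    by (simp add: sum_negf)
qed

end

section \<open>Partial compositions and insertion of cycles\<close>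

context sigma_dg_operad
begin

lemma circ_linear_left:
  "\<lbrakk>y \<in> Op m l; 1 \<le> i; i \<le> n; N = n + m - 1; R = r + l\<rbrakk> \<Longrightarrow>
    linear_map_on scale (Op n r) (Op N R) (\<lambda>x. circ n r m l i x y)"
  using circ_bilinear unfolding bilinear_map_on_def by blast

lemma circ_linear_right:
  "\<lbrakk>x \<in> Op n r; 1 \<le> i; i \<le> n; N = n + m - 1; R = r + l\<rbrakk> \<Longrightarrow>
    linear_map_on scale (Op m l) (Op N R) (circ n r m l i x)"
  using circ_bilinear unfolding bilinear_map_on_def by blast

lemma circ_in:
  "\<lbrakk>x \<in> Op n r; y \<in> Op m l; 1 \<le> i; i \<le> n; N = n + m - 1; R = r + l\<rbrakk> \<Longrightarrow>
    circ n r m l i x y \<in> Op N R"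
  using circ_linear_right unfolding linear_map_on_def by blast

lemma circ_zero_left: "\<lbrakk>y \<in> Op m l; 1 \<le> i; i \<le> n\<rbrakk> \<Longrightarrow> circ n r m l i 0 y = 0"
  using linear_map_on_zero[OF circ_linear_left subspace_component] by blast

lemma circ_zero_right: "\<lbrakk>x \<in> Op n r; 1 \<le> i; i \<le> n\<rbrakk> \<Longrightarrow> circ n r m l i x 0 = 0"
  using linear_map_on_zero[OF circ_linear_right subspace_component] by blast

text \<open>The associativity axioms with the arities, degrees and positions of the composites left free,
  so that they unify with terms in which these have been simplified.\<close>

lemma circ_sequential:
  "\<lbrakk>x \<in> Op n r; y \<in> Op m l; z \<in> Op p t; 1 \<le> i; i \<le> n; 1 \<le> j; j \<le> m;
    N = n + m - 1; R = r + l; k = i + j - 1; M = m + p - 1; L = l + t\<rbrakk> \<Longrightarrow>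
    circ N R p t k (circ n r m l i x y) z = circ n r M L i x (circ m l p t j y z)"
  using circ_assoc_sequential by simp

lemma circ_parallel:
  "\<lbrakk>x \<in> Op n r; y \<in> Op m l; z \<in> Op p t; 1 \<le> i; i < k; k \<le> n; l = 0 \<or> t = 0;
    N = n + m - 1; R = r + l; k' = k + m - 1; N' = n + p - 1; R' = r + t\<rbrakk> \<Longrightarrow>
    circ N R p t k' (circ n r m l i x y) z = circ N' R' m l i (circ n r p t k x z) y"
  using circ_assoc_parallel[of x n r y m l z p t i k] by auto

text \<open>The Leibniz term containing \<open>d m 0 z\<close> is a composition with 0. This covers
  codegeneracies and inner cofaces; the companion with the cycle on the left covers outer cofaces,
  its sign being \<open>(-1) ^ 0\<close>.\<close>

lemma d_circ_cycle_right:
  assumes "x \<in> Op n r" "z \<in> Op m 0" "d m 0 z = 0" "1 \<le> i" "i \<le> n" "N = n + m - 1"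
  shows "d N r (circ n r m 0 i x z) = circ n (r - 1) m 0 i (d n r x) z"
  using d_circ[OF assms(1,2,4,5)] assms by (simp add: circ_zero_right)

lemma d_circ_cycle_left:
  assumes "z \<in> Op n 0" "x \<in> Op m r" "d n 0 z = 0" "1 \<le> i" "i \<le> n" "N = n + m - 1"
  shows "d N r (circ n 0 m r i z x) = circ n 0 m (r - 1) i z (d m r x)"
  using d_circ[OF assms(1,2,4,5)] assms by (simp add: circ_zero_left)

end

section \<open>The product and its algebra structure\<close>

locale unital_multiplicative_operad =
  free_pointed_multiplicative_sigma_dg_operad scale Op d act one circ B \<mu> \<eta>
  for scale :: "'k::field \<Rightarrow> 'a::ab_group_add \<Rightarrow> 'a" (infixr \<open>*s\<close> 75)
    and Op d act one circ B \<mu> \<eta> +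
  assumes mu_unit_left: "circ 2 0 0 0 1 \<mu> (\<eta> 1) = one"
    and mu_unit_right: "circ 2 0 0 0 2 \<mu> (\<eta> 1) = one"
begin

lemma mu_circ_in:
  "\<lbrakk>x \<in> Op p u; 1 \<le> i; i \<le> 2; N = Suc p\<rbrakk> \<Longrightarrow> circ 2 0 p u i \<mu> x \<in> Op N u"
  using mu_in by (auto intro!: circ_in)

text \<open>Parallel associativity for the two slots of \<open>\<mu>\<close>: once \<open>x\<close>
  fills slot 1, slot 2 has moved to position \<open>p + 1\<close>. No sign appears because
  \<open>z\<close> has degree 0; it is applied to \<open>z = \<mu>\<close> and
  \<open>z = \<eta> 1\<close>.\<close>

lemma mu_1_Suc:
  "\<lbrakk>x \<in> Op p u; z \<in> Op m 0\<rbrakk> \<Longrightarrow>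
    circ (Suc p) u m 0 (Suc p) (circ 2 0 p u 1 \<mu> x) z
    = circ (Suc m) 0 p u 1 (circ 2 0 m 0 2 \<mu> z) x"
  using mu_in by (intro circ_parallel[where k = 2]) auto

lemma odot_bilinear:
  "bilinear_map_on scale (Op p u) (Op q v) (Op (p + q) (u + v)) (odot circ \<mu> p u q v)"
proof -
  have "linear_map_on scale (Op p u) (Op (p + q) (u + v)) (\<lambda>x. odot circ \<mu> p u q v x y)"
    if y: "y \<in> Op q v" for y
    using circ_linear_left[OF y, of "Suc p" "Suc p" "p + q" "u + v" u]
      circ_linear_right[OF mu_in, of 1 "Suc p" p u u]
    by (simp add: linear_map_on_def odot_def)
  moreover have "linear_map_on scale (Op q v) (Op (p + q) (u + v)) (odot circ \<mu> p u q v x)"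
    if x: "x \<in> Op p u" for x
    using circ_linear_right[OF mu_circ_in[OF x], of 1 "Suc p" "Suc p" "p + q" q "u + v" v]
    by (simp add: linear_map_on_def odot_def)
  ultimately show ?thesis
    by (simp add: bilinear_map_on_def)
qed

lemma odot_in:
  "\<lbrakk>x \<in> Op p u; y \<in> Op q v; N = p + q; R = u + v\<rbrakk> \<Longrightarrow> odot circ \<mu> p u q v x y \<in> Op N R"
  using odot_bilinear unfolding bilinear_map_on_def linear_map_on_def by blast

lemma odot_linear_left:
  "y \<in> Op q v \<Longrightarrow>
    linear_map_on scale (Op p u) (Op (p + q) (u + v)) (\<lambda>x. odot circ \<mu> p u q v x y)"
  using odot_bilinear by (simp add: bilinear_map_on_def)

lemma odot_linear_right:
  "x \<in> Op p u \<Longrightarrow>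
    linear_map_on scale (Op q v) (Op (p + q) (u + v)) (odot circ \<mu> p u q v x)"
  using odot_bilinear by (simp add: bilinear_map_on_def)

lemmas odot_sum_left = linear_map_on_sum[OF odot_linear_left subspace_component]
lemmas odot_sum_right = linear_map_on_sum[OF odot_linear_right subspace_component]

text \<open>Sequential associativity takes \<open>z\<close> out of
  \<open>\<mu> \<circ>_1 (x \<circ>_i z)\<close>; parallel associativity then moves it past
  \<open>y\<close>, which is where degree 0 is used. The slot for \<open>y\<close> shifts from
  \<open>p + 1\<close> to \<open>p + m\<close>.\<close>

lemma odot_circ_left:
  assumes x: "x \<in> Op p u" and y: "y \<in> Op q v" and z: "z \<in> Op m 0"
    and i: "1 \<le> i" "i \<le> p" and N: "N = p + m - 1"
  shows "odot circ \<mu> N u q v (circ p u m 0 i x z) y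
    = circ (p + q) (u + v) m 0 i (odot circ \<mu> p u q v x y) z"
proof -
  have "circ 2 0 N u 1 \<mu> (circ p u m 0 i x z) = circ (Suc p) u m 0 i (circ 2 0 p u 1 \<mu> x) z"
    using x z i N mu_in by (intro circ_sequential[symmetric]) auto
  moreover have "circ (Suc N) u q v (Suc N) (circ (Suc p) u m 0 i (circ 2 0 p u 1 \<mu> x) z) y
      = circ (p + q) (u + v) m 0 i (circ (Suc p) u q v (Suc p) (circ 2 0 p u 1 \<mu> x) y) z"
    using x y z i N by (intro circ_parallel mu_circ_in) auto
  ultimately show ?thesis
    by (simp add: odot_def)
qed

text \<open>Here \<open>z\<close> is inserted into the last factor, so sequential associativity
  alone suffices and \<open>z\<close> may have any degree.\<close>

lemma odot_circ_right:
  assumes x: "x \<in> Op p u" and y: "y \<in> Op q v" and z: "z \<in> Op m w"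
    and i: "1 \<le> i" "i \<le> q" and N: "N = q + m - 1" and R: "R = v + w"
  shows "odot circ \<mu> p u N R x (circ q v m w i y z)
    = circ (p + q) (u + v) m w (p + i) (odot circ \<mu> p u q v x y) z"
  unfolding odot_def using assms by (intro circ_sequential[symmetric] mu_circ_in) auto

text \<open>Both bracketings reduce to \<open>\<mu>(x, -)\<close> with \<open>\<mu>(y, -)\<close>
  inserted at \<open>p + 1\<close> and \<open>z\<close> in the last slot.\<close>

lemma odot_assoc:
  assumes x: "x \<in> Op p u" and y: "y \<in> Op q v" and z: "z \<in> Op s w"
  shows "odot circ \<mu> (p + q) (u + v) s w (odot circ \<mu> p u q v x y) z
    = odot circ \<mu> p u (q + s) (v + w) x (odot circ \<mu> q v s w y z)"
proof -
  have mx: "circ 2 0 p u 1 \<mu> x \<in> Op (Suc p) u" and my: "circ 2 0 q v 1 \<mu> y \<in> Op (Suc q) v"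
    using x y by (auto intro: mu_circ_in)
  \<comment> \<open>The only use of associativity of \<open>\<mu>\<close>:
    \<open>\<mu>(\<mu>(x, -), -)\<close> is rewritten as
    \<open>\<mu>(x, \<mu>(-, -))\<close>.\<close>
  have mu2: "circ 2 0 (Suc p) u 1 \<mu> (circ 2 0 p u 1 \<mu> x)
      = circ (Suc p) u 2 0 (Suc p) (circ 2 0 p u 1 \<mu> x) \<mu>"
    using circ_sequential[OF mu_in mu_in x, of 1 1 3 0 1 "Suc p" u] mu_1_Suc[OF x mu_in] mu_assoc
    by (simp add: numeral_3_eq_3)
  have "circ 2 0 (p + q) (u + v) 1 \<mu> (odot circ \<mu> p u q v x y)
      = circ (Suc (Suc p)) u q v (Suc p) (circ 2 0 (Suc p) u 1 \<mu> (circ 2 0 p u 1 \<mu> x)) y"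
    unfolding odot_def Suc_eq_plus1[symmetric] using mx y mu_in by (intro circ_sequential[symmetric]) auto
  also have "\<dots> = circ (Suc p) u (Suc q) v (Suc p) (circ 2 0 p u 1 \<mu> x) (circ 2 0 q v 1 \<mu> y)"
    unfolding mu2 using mx y mu_in by (intro circ_sequential) auto
  finally have "odot circ \<mu> (p + q) (u + v) s w (odot circ \<mu> p u q v x y) z
      = circ (Suc (p + q)) (u + v) s w (Suc (p + q))
          (circ (Suc p) u (Suc q) v (Suc p) (circ 2 0 p u 1 \<mu> x) (circ 2 0 q v 1 \<mu> y)) z"
    by (simp add: odot_def[of _ _ "p + q"])
  also have "\<dots> = odot circ \<mu> p u (q + s) (v + w) x (odot circ \<mu> q v s w y z)"
    \<comment> \<open>\<open>z\<close> fills the last slot of \<open>\<mu>(y, -)\<close>, of arity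
      \<open>Suc q\<close>. That slot does not occur in the term being rewritten, so it is given
      explicitly.\<close>
    unfolding odot_def using mx my z by (subst circ_sequential[of _ _ _ _ "Suc q" _ _ _ _ _ "Suc q"]) auto
  finally show ?thesis .
qed

lemma unit_odot: "x \<in> Op p u \<Longrightarrow> odot circ \<mu> 0 0 p u (\<eta> 1) x = x"
  using one_circ mu_unit_left by (simp add: odot_def)

lemma odot_unit:
  assumes "x \<in> Op p u"
  shows "odot circ \<mu> p u 0 0 x (\<eta> 1) = x"
  using mu_1_Suc[OF assms eta_in] one_circ[OF assms] by (simp add: odot_def mu_unit_right)

lemma d_odot:
  assumes x: "x \<in> Op p u" and y: "y \<in> Op q v"
  shows "d (p + q) (u + v) (odot circ \<mu> p u q v x y) =
    odot circ \<mu> p (u - 1) q v (d p u x) y + (-1) ^ u *s odot circ \<mu> p u q (v - 1) x (d q v y)"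
proof -
  \<comment> \<open>Since \<open>\<mu>\<close> is a cycle of degree 0, \<open>\<mu>(x, -)\<close>
    still has degree \<open>u\<close>, which produces the sign \<open>(-1) ^ u\<close> in the outer
    Leibniz rule.\<close>
  have "d (Suc p) u (circ 2 0 p u 1 \<mu> x) = circ 2 0 p (u - 1) 1 \<mu> (d p u x)"
    using x mu_in d_mu by (intro d_circ_cycle_left) auto
  then show ?thesis
    using d_circ[OF mu_circ_in[OF x] y, of 1 "Suc p" "Suc p"] by (simp add: odot_def)
qed

lemma chain_complex_algebra_odot: "chain_complex_algebra scale Op d (odot circ \<mu>) (\<eta> 1)"
  by unfold_locales (fact odot_bilinear odot_assoc eta_in unit_odot odot_unit d_odot)+

section \<open>The boundary operator\<close>

lemma boundary_linear:
  "linear_map_on scale (Op n r) (int_component Op (int n + -1) r) (boundary scale circ (\<eta> 1) n r)"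
proof (cases "n = 0")
  \<comment> \<open>In arity 0 the sum is empty, and the target, of arity -1, is
    \<open>{0}\<close>.\<close>
  case True
  then show ?thesis
    by (simp add: linear_map_on_def boundary_def int_component_def)
next
  case False
  then have "int_component Op (int n + -1) r = Op (n - 1) r"
    by (simp add: int_component_def nat_diff_distrib)
  moreover have "linear_map_on scale (Op n r) (Op (n - 1) r) (boundary scale circ (\<eta> 1) n r)"
    unfolding boundary_def codegeneracy_def
    by (intro linear_map_on_sum_maps circ_linear_left subspace_component eta_in) auto
  ultimately show ?thesis
    by simp
qed

lemma boundary_boundary:
  assumes x: "x \<in> Op n r"
  shows "boundary scale circ (\<eta> 1) (n - 1) r (boundary scale circ (\<eta> 1) n r x) = 0"
proof (cases "n \<le> 1")
  \<comment> \<open>The outer sum runs over \<open>1..n - 1\<close> and is empty.\<close>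
  case True
  then show ?thesis
    by (simp add: boundary_def)
next
  case False
  then obtain N where n: "n = Suc (Suc N)"
    by (metis Suc_1 add_2_eq_Suc le_add_diff_inverse nat_le_linear not_less_eq_eq)
  \<comment> \<open>Both indices are shifted to start at 0, which leaves the sign of each double
    term unchanged. Filling slot \<open>Suc i\<close> with \<open>\<eta> 1\<close> moves the later
    slot \<open>Suc j\<close> to \<open>j\<close>, which yields the symmetry of
    \<open>F\<close>.\<close>
  define F where "F = (\<lambda>i j. circ (Suc N) r 0 0 (Suc i) (circ n r 0 0 (Suc j) x (\<eta> 1)) (\<eta> 1))"
  have F: "F i j = F (j - 1) i" if "i < j" "j \<le> Suc N" for i j
    unfolding F_def using that x eta_in n by (intro circ_parallel[symmetric]) auto
  have sh: "(\<Sum>i = Suc 0..Suc M. h i) = (\<Sum>i\<le>M. h (Suc i))" for h :: "nat \<Rightarrow> 'a" and M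
    by (simp only: sum.shift_bounds_cl_Suc_ivl atLeast0AtMost)
  have "boundary scale circ (\<eta> 1) (n - 1) r (boundary scale circ (\<eta> 1) n r x)
      = (\<Sum>i\<le>N. (-1) ^ Suc i *s circ (Suc N) r 0 0 (Suc i)
          (\<Sum>j\<le>Suc N. (-1) ^ Suc j *s circ n r 0 0 (Suc j) x (\<eta> 1)) (\<eta> 1))"
    by (simp add: boundary_def codegeneracy_def n sh del: power_Suc sum.atMost_Suc sum.cl_ivl_Suc)
  also have "\<dots> = (\<Sum>i\<le>N. (-1) ^ Suc i *s (\<Sum>j\<le>Suc N. (-1) ^ Suc j *s F i j))"
  proof (rule sum.cong[OF refl])
    fix i assume "i \<in> {..N}"
    then have "circ (Suc N) r 0 0 (Suc i)
          (\<Sum>j\<le>Suc N. (-1) ^ Suc j *s circ n r 0 0 (Suc j) x (\<eta> 1)) (\<eta> 1)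
        = (\<Sum>j\<le>Suc N. (-1) ^ Suc j *s F i j)"
      unfolding F_def using x eta_in n
      by (intro linear_map_on_sum[OF circ_linear_left subspace_component] circ_in) auto
    then show "(-1) ^ Suc i *s circ (Suc N) r 0 0 (Suc i)
          (\<Sum>j\<le>Suc N. (-1) ^ Suc j *s circ n r 0 0 (Suc j) x (\<eta> 1)) (\<eta> 1)
        = (-1) ^ Suc i *s (\<Sum>j\<le>Suc N. (-1) ^ Suc j *s F i j)"
      by simp
  qed
  also have "\<dots> = (\<Sum>i\<le>N. \<Sum>j\<le>Suc N. (-1) ^ (i + j) *s F i j)"
    by (simp add: scale_sum_right power_add del: sum.atMost_Suc)
  also have "\<dots> = 0"
    using F by (rule alternating_double_sum_eq_0)
  finally show ?thesis .
qed

lemma boundary_d: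
  assumes x: "x \<in> Op n r"
  shows "boundary scale circ (\<eta> 1) n (r - 1) (d n r x)
    = d (n - 1) r (boundary scale circ (\<eta> 1) n r x)"
proof -
  have "d (n - 1) r (boundary scale circ (\<eta> 1) n r x)
      = (\<Sum>i = 1..n. (-1) ^ i *s d (n - 1) r (circ n r 0 0 i x (\<eta> 1)))"
    unfolding boundary_def codegeneracy_def using x eta_in
    by (intro linear_map_on_sum[OF d_linear subspace_component] circ_in) auto
  also have "\<dots> = (\<Sum>i = 1..n. (-1) ^ i *s circ n (r - 1) 0 0 i (d n r x) (\<eta> 1))"
    using x eta_in d_eta by (intro sum.cong refl arg_cong[of _ _ "scale _"] d_circ_cycle_right) auto
  finally show ?thesis
    by (simp add: boundary_def codegeneracy_def)
qed

lemma boundary_odot: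
  assumes x: "x \<in> Op p u" and y: "y \<in> Op q v"
  shows "boundary scale circ (\<eta> 1) (p + q) (u + v) (odot circ \<mu> p u q v x y) =
    odot circ \<mu> (p - 1) u q v (boundary scale circ (\<eta> 1) p u x) y +
    (-1) ^ p *s odot circ \<mu> p u (q - 1) v x (boundary scale circ (\<eta> 1) q v y)"
proof -
  \<comment> \<open>Slots \<open>1..p\<close> of the product belong to \<open>x\<close> and
    \<open>p + 1..p + q\<close> to \<open>y\<close>; the shift by \<open>p\<close> accounts for the
    sign. For \<open>p = 0\<close> or \<open>q = 0\<close> the truncated arity is harmless, as the
    corresponding sum is empty.\<close>
  define S where "S = (\<lambda>i. circ (p + q) (u + v) 0 0 i (odot circ \<mu> p u q v x y) (\<eta> 1))"
  have "odot circ \<mu> (p - 1) u q v (boundary scale circ (\<eta> 1) p u x) y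
      = (\<Sum>i = 1..p. (-1) ^ i *s odot circ \<mu> (p - 1) u q v (circ p u 0 0 i x (\<eta> 1)) y)"
    unfolding boundary_def codegeneracy_def using x y eta_in
    by (intro odot_sum_left circ_in) auto
  also have "\<dots> = (\<Sum>i = 1..p. (-1) ^ i *s S i)"
    unfolding S_def using x y eta_in
    by (intro sum.cong refl arg_cong[of _ _ "scale _"] odot_circ_left) auto
  finally have left: "odot circ \<mu> (p - 1) u q v (boundary scale circ (\<eta> 1) p u x) y
      = (\<Sum>i = 1..p. (-1) ^ i *s S i)" .
  have "odot circ \<mu> p u (q - 1) v x (boundary scale circ (\<eta> 1) q v y)
      = (\<Sum>i = 1..q. (-1) ^ i *s odot circ \<mu> p u (q - 1) v x (circ q v 0 0 i y (\<eta> 1)))"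
    unfolding boundary_def codegeneracy_def using x y eta_in
    by (intro odot_sum_right circ_in) auto
  also have "\<dots> = (\<Sum>i = 1..q. (-1) ^ i *s S (p + i))"
    unfolding S_def using x y eta_in
    by (intro sum.cong refl arg_cong[of _ _ "scale _"] odot_circ_right) auto
  finally have right: "(-1) ^ p *s odot circ \<mu> p u (q - 1) v x (boundary scale circ (\<eta> 1) q v y)
      = (\<Sum>i = 1..q. (-1) ^ (p + i) *s S (p + i))"
    by (simp add: scale_sum_right power_add)
  have "(\<Sum>i = 1..p + q. (-1) ^ i *s S i)
      = (\<Sum>i = 1..p. (-1) ^ i *s S i) + (\<Sum>i = p + 1..p + q. (-1) ^ i *s S i)"
    by (intro sum.ub_add_nat) simp
  also have "(\<Sum>i = p + 1..p + q. (-1) ^ i *s S i) = (\<Sum>i = 1..q. (-1) ^ (p + i) *s S (p + i))"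
    using sum.shift_bounds_cl_nat_ivl[of "\<lambda>i. (-1) ^ i *s S i" 1 p q] by (simp add: add.commute)
  finally show ?thesis
    unfolding left right by (simp add: boundary_def codegeneracy_def S_def)
qed

lemma bicomplex_algebra_boundary:
  "bicomplex_algebra scale Op d (odot circ \<mu>) (\<eta> 1) (-1) (boundary scale circ (\<eta> 1))"
proof -
  have pred: "nat (int n + -1) = n - 1" for n
    by simp
  show ?thesis
    by (intro bicomplex_algebra.intro chain_complex_algebra_odot bicomplex_algebra_axioms.intro;
        (unfold pred)?)
      (fact boundary_linear boundary_boundary boundary_d boundary_odot | simp)+
qed

section \<open>Cofaces, the cosimplicial identities and the product\<close>

lemma coface_linear:
  "i \<le> Suc n \<Longrightarrow> linear_map_on scale (Op n r) (Op (Suc n) r) (coface circ \<mu> n r i)"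
  using circ_linear_right[OF mu_in, of 1 "Suc n" n r r] circ_linear_right[OF mu_in, of 2 "Suc n" n r r]
    circ_linear_left[OF mu_in, of i n "Suc n" r r]
  by (auto simp: linear_map_on_def coface_def)

lemma coface_in: "\<lbrakk>x \<in> Op n r; i \<le> Suc n\<rbrakk> \<Longrightarrow> coface circ \<mu> n r i x \<in> Op (Suc n) r"
  using coface_linear unfolding linear_map_on_def by blast

text \<open>Associativity of \<open>\<mu>\<close> is needed where the two copies of
  \<open>\<mu>\<close> meet: when \<open>x\<close> is the middle, last or first factor of a triple
  product (cases 1, 2, 5), or when both copies enter the same slot of \<open>x\<close> (case 6).
  Otherwise operadic associativity suffices: sequential for one outer coface (cases 3, 4), parallel
  for distinct slots (case 7).\<close>

lemma coface_coface:
  assumes x: "x \<in> Op n r" and ij: "i < j" "j \<le> n + 2"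
  shows "coface circ \<mu> (Suc n) r j (coface circ \<mu> n r i x)
    = coface circ \<mu> (Suc n) r i (coface circ \<mu> n r (j - 1) x)"
proof -
  have mu_mu: "circ 3 0 n r k (circ 2 0 2 0 i \<mu> \<mu>) x = circ 2 0 (Suc n) r i \<mu> (circ 2 0 n r j \<mu> x)"
    if "1 \<le> i" "i \<le> 2" "1 \<le> j" "j \<le> 2" "k = i + j - 1" for i j k
    using that x mu_in by (intro circ_sequential) auto
  have mu_x: "circ (Suc n) r 2 0 k (circ 2 0 n r i \<mu> x) \<mu> = circ 2 0 (Suc n) r i \<mu> (circ n r 2 0 j x \<mu>)"
    if "1 \<le> i" "i \<le> 2" "1 \<le> j" "j \<le> n" "k = i + j - 1" for i j k
    using that x mu_in by (intro circ_sequential) auto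
  consider "i = 0" "j = n + 2" | "i = 0" "j = 1" | "i = 0" "2 \<le> j" "j \<le> n + 1"
    | "1 \<le> i" "i \<le> n" "j = n + 2" | "i = n + 1" "j = n + 2"
    | "1 \<le> i" "i \<le> n" "j = Suc i" | "1 \<le> i" "Suc i < j" "j \<le> n + 1"
    using ij by linarith
  then show ?thesis
  proof cases
    case 1
    then show ?thesis
      using mu_mu[of 1 2 2] mu_mu[of 2 1 2] mu_assoc by (simp add: coface_def)
  next
    case 2
    have "circ 3 0 n r 3 (circ 2 0 2 0 1 \<mu> \<mu>) x = circ (Suc n) r 2 0 1 (circ 2 0 n r 2 \<mu> x) \<mu>"
      using x mu_in by (intro circ_parallel) auto
    then show ?thesis
      using 2 mu_mu[of 2 2 3] mu_assoc by (simp add: coface_def)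
  next
    case 3
    then show ?thesis
      using mu_x[of 2 "j - 1" j] by (auto simp: coface_def)
  next
    case 4
    then show ?thesis
      using mu_x[of 1 i i] by (auto simp: coface_def)
  next
    case 5
    then show ?thesis
      using mu_mu[of 1 1 1] mu_1_Suc[OF x mu_in] mu_assoc by (simp add: coface_def numeral_3_eq_3)
  next
    case 6
    \<comment> \<open>Inserting \<open>\<mu>\<close> at \<open>i\<close> creates the slots
      \<open>i\<close> and \<open>i + 1\<close>; \<open>j\<close> selects which of them receives the
      second copy.\<close>
    have "circ (Suc n) r 2 0 k (circ n r 2 0 i x \<mu>) \<mu> = circ n r 3 0 i x (circ 2 0 2 0 j \<mu> \<mu>)"
      if "1 \<le> j" "j \<le> 2" "k = i + j - 1" for j k
      using that 6 x mu_in by (intro circ_sequential) auto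
    from this[of 1 i] this[of 2 "Suc i"] show ?thesis
      using 6 mu_assoc by (simp add: coface_def)
  next
    case 7
    then have "circ (Suc n) r 2 0 j (circ n r 2 0 i x \<mu>) \<mu> = circ (Suc n) r 2 0 i (circ n r 2 0 (j - 1) x \<mu>) \<mu>"
      using x mu_in by (intro circ_parallel) auto
    with 7 show ?thesis
      by (auto simp: coface_def)
  qed
qed

lemma coface_d:
  assumes x: "x \<in> Op n r" and i: "i \<le> Suc n"
  shows "d (Suc n) r (coface circ \<mu> n r i x) = coface circ \<mu> n (r - 1) i (d n r x)"
proof -
  have "d (Suc n) r (circ 2 0 n r k \<mu> x) = circ 2 0 n (r - 1) k \<mu> (d n r x)"
    if "1 \<le> k" "k \<le> 2" for k
    using that x mu_in d_mu by (intro d_circ_cycle_left) auto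
  moreover have "d (Suc n) r (circ n r 2 0 i x \<mu>) = circ n (r - 1) 2 0 i (d n r x) \<mu>"
    if "i \<noteq> 0" "i \<noteq> Suc n"
    using that i x mu_in d_mu by (intro d_circ_cycle_right) auto
  ultimately show ?thesis
    by (simp add: coface_def)
qed

lemma coface_0: "x \<in> Op n r \<Longrightarrow> coface circ \<mu> n r 0 x = odot circ \<mu> 1 0 n r one x"
  using circ_one[OF mu_in, of 1] by (simp add: coface_def odot_def numeral_2_eq_2)

lemma coface_Suc: "x \<in> Op n r \<Longrightarrow> coface circ \<mu> n r (Suc n) x = odot circ \<mu> n r 1 0 x one"
  using circ_one[OF mu_circ_in, of x n r 1 "Suc n" "Suc n"] by (simp add: coface_def odot_def)

text \<open>For \<open>i = 0\<close> this is associativity of the product with left factor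
  \<open>one\<close>; for inner cofaces it is insertion of \<open>\<mu>\<close> into
  \<open>x\<close>. The last coface of \<open>x\<close> is excluded, as it places \<open>one\<close>
  between \<open>x\<close> and \<open>y\<close>.\<close>

lemma odot_coface_left:
  assumes x: "x \<in> Op p u" and y: "y \<in> Op q v" and i: "i \<le> p"
  shows "odot circ \<mu> (Suc p) u q v (coface circ \<mu> p u i x) y
    = coface circ \<mu> (p + q) (u + v) i (odot circ \<mu> p u q v x y)"
proof (cases "i = 0")
  case True
  then show ?thesis
    using odot_assoc[OF one_in x y] by (simp add: coface_0 x y odot_in)
next
  case False
  then show ?thesis
    using odot_circ_left[OF x y mu_in, of i "Suc p"] i by (simp add: coface_def)
qed

lemma odot_coface_right:
  assumes x: "x \<in> Op p u" and y: "y \<in> Op q v" and i: "1 \<le> i" "i \<le> Suc q"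
  shows "odot circ \<mu> p u (Suc q) v x (coface circ \<mu> q v i y)
    = coface circ \<mu> (p + q) (u + v) (p + i) (odot circ \<mu> p u q v x y)"
proof (cases "i = Suc q")
  case True
  then show ?thesis
    using odot_assoc[OF x y one_in] by (simp add: coface_Suc x y odot_in)
next
  case False
  then show ?thesis
    using odot_circ_right[OF x y mu_in, of i "Suc q" v] i by (simp add: coface_def)
qed

section \<open>The coboundary operator\<close>

lemma coboundary_linear:
  "linear_map_on scale (Op n r) (Op (Suc n) r) (coboundary scale circ \<mu> n r)"
  unfolding coboundary_def
  by (intro linear_map_on_sum_maps coface_linear subspace_component) auto

lemma coboundary_coboundary:
  assumes x: "x \<in> Op n r"
  shows "coboundary scale circ \<mu> (Suc n) r (coboundary scale circ \<mu> n r x) = 0"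
proof -
  \<comment> \<open>The second argument is the outer coface, so that \<open>i < j\<close> matches
    the cosimplicial identity; the two sums are therefore exchanged below.\<close>
  define F where "F = (\<lambda>i j. coface circ \<mu> (Suc n) r j (coface circ \<mu> n r i x))"
  have "coboundary scale circ \<mu> (Suc n) r (coboundary scale circ \<mu> n r x)
      = (\<Sum>j\<le>Suc (Suc n). (-1) ^ j *s coface circ \<mu> (Suc n) r j
          (\<Sum>i\<le>Suc n. (-1) ^ i *s coface circ \<mu> n r i x))"
    by (simp add: coboundary_def atLeast0AtMost del: sum.atMost_Suc)
  also have "\<dots> = (\<Sum>j\<le>Suc (Suc n). (-1) ^ j *s (\<Sum>i\<le>Suc n. (-1) ^ i *s F i j))"
    unfolding F_def using x
    by (intro sum.cong refl arg_cong[of _ _ "scale _"]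
        linear_map_on_sum[OF coface_linear subspace_component] coface_in) auto
  also have "\<dots> = (\<Sum>i\<le>Suc n. \<Sum>j\<le>Suc (Suc n). (-1) ^ (i + j) *s F i j)"
    by (subst sum.swap) (simp add: scale_sum_right power_add mult.commute del: sum.atMost_Suc)
  also have "\<dots> = 0"
    by (intro alternating_double_sum_eq_0) (simp add: F_def coface_coface x)
  finally show ?thesis .
qed

lemma coboundary_d:
  assumes x: "x \<in> Op n r"
  shows "coboundary scale circ \<mu> n (r - 1) (d n r x) = d (Suc n) r (coboundary scale circ \<mu> n r x)"
proof -
  have "d (Suc n) r (coboundary scale circ \<mu> n r x)
      = (\<Sum>i = 0..n + 1. (-1) ^ i *s d (Suc n) r (coface circ \<mu> n r i x))"
    unfolding coboundary_def using x
    by (intro linear_map_on_sum[OF d_linear subspace_component] coface_in) auto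
  also have "\<dots> = coboundary scale circ \<mu> n (r - 1) (d n r x)"
    unfolding coboundary_def using x
    by (intro sum.cong refl arg_cong[of _ _ "scale _"] coface_d) auto
  finally show ?thesis ..
qed

lemma coboundary_odot:
  assumes x: "x \<in> Op p u" and y: "y \<in> Op q v"
  shows "coboundary scale circ \<mu> (p + q) (u + v) (odot circ \<mu> p u q v x y) =
    odot circ \<mu> (Suc p) u q v (coboundary scale circ \<mu> p u x) y +
    (-1) ^ p *s odot circ \<mu> p u (Suc q) v x (coboundary scale circ \<mu> q v y)"
proof -
  define D where "D = (\<lambda>i. coface circ \<mu> (p + q) (u + v) i (odot circ \<mu> p u q v x y))"
  \<comment> \<open>\<open>E\<close> is \<open>x \<odot> one \<odot> y\<close>. It occurs with sign
    \<open>(-1) ^ (p + 1)\<close> from the last coface of \<open>x\<close> and with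
    \<open>(-1) ^ p\<close> from the zeroth coface of \<open>y\<close>.\<close>
  define E where "E = odot circ \<mu> (Suc p) u q v (coface circ \<mu> p u (Suc p) x) y"
  have E: "odot circ \<mu> p u (Suc q) v x (coface circ \<mu> q v 0 y) = E"
    using odot_assoc[OF x one_in y] by (simp add: E_def coface_0 coface_Suc x y)
  have "odot circ \<mu> (Suc p) u q v (coboundary scale circ \<mu> p u x) y
      = (\<Sum>i = 0..p + 1. (-1) ^ i *s odot circ \<mu> (Suc p) u q v (coface circ \<mu> p u i x) y)"
    unfolding coboundary_def using x y by (intro odot_sum_left coface_in) auto
  also have "\<dots> = (\<Sum>i = 0..p. (-1) ^ i *s D i) - (-1) ^ p *s E"
    using x y by (simp add: D_def E_def odot_coface_left)
  finally have left: "odot circ \<mu> (Suc p) u q v (coboundary scale circ \<mu> p u x) y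
      = (\<Sum>i = 0..p. (-1) ^ i *s D i) - (-1) ^ p *s E" .
  have "odot circ \<mu> p u (Suc q) v x (coboundary scale circ \<mu> q v y)
      = (\<Sum>i = 0..q + 1. (-1) ^ i *s odot circ \<mu> p u (Suc q) v x (coface circ \<mu> q v i y))"
    unfolding coboundary_def using x y by (intro odot_sum_right coface_in) auto
  also have "\<dots> = E + (\<Sum>i = 1..q + 1. (-1) ^ i *s D (p + i))"
    using x y by (simp add: D_def E odot_coface_right sum.atLeast_Suc_atMost[of 0] del: sum.cl_ivl_Suc)
  finally have right: "(-1) ^ p *s odot circ \<mu> p u (Suc q) v x (coboundary scale circ \<mu> q v y)
      = (-1) ^ p *s E + (\<Sum>i = 1..q + 1. (-1) ^ (p + i) *s D (p + i))"
    by (simp add: scale_right_distrib scale_sum_right power_add del: sum.cl_ivl_Suc)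
  \<comment> \<open>After \<open>E\<close> cancels, \<open>x\<close> supplies the cofaces
    \<open>0..p\<close> of the product and \<open>y\<close> supplies
    \<open>p + 1..p + q + 1\<close>.\<close>
  have "(\<Sum>i = 0..p + (q + 1). (-1) ^ i *s D i)
      = (\<Sum>i = 0..p. (-1) ^ i *s D i) + (\<Sum>i = p + 1..p + (q + 1). (-1) ^ i *s D i)"
    by (intro sum.ub_add_nat) simp
  also have "(\<Sum>i = p + 1..p + (q + 1). (-1) ^ i *s D i)
      = (\<Sum>i = 1..q + 1. (-1) ^ (p + i) *s D (p + i))"
    using sum.shift_bounds_cl_nat_ivl[of "\<lambda>i. (-1) ^ i *s D i" 1 p "q + 1"]
    by (simp add: add.commute del: sum.cl_ivl_Suc)
  finally show ?thesis
    unfolding left right by (simp add: coboundary_def D_def add.assoc del: sum.cl_ivl_Suc)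
qed

lemma bicomplex_algebra_coboundary:
  "bicomplex_algebra scale Op d (odot circ \<mu>) (\<eta> 1) 1 (coboundary scale circ \<mu>)"
proof -
  have Suc: "nat (int n + 1) = Suc n" "int_component Op (int n + 1) r = Op (Suc n) r" for n r
    by (simp_all add: int_component_def nat_add_distrib)
  show ?thesis
    by (intro bicomplex_algebra.intro chain_complex_algebra_odot bicomplex_algebra_axioms.intro;
        (unfold Suc)?)
      (fact coboundary_linear coboundary_coboundary coboundary_d coboundary_odot | simp)+
qed

end

theorem proposition3p3:
  fixes scale :: "'k::field \<Rightarrow> 'a::ab_group_add \<Rightarrow> 'a"
    and Op :: "nat \<Rightarrow> nat \<Rightarrow> 'a set"
    and d :: "nat \<Rightarrow> nat \<Rightarrow> 'a \<Rightarrow> 'a"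
    and act :: "nat \<Rightarrow> nat \<Rightarrow> 'a \<Rightarrow> (nat \<Rightarrow> nat) \<Rightarrow> 'a"
    and one :: 'a
    and circ :: "nat \<Rightarrow> nat \<Rightarrow> nat \<Rightarrow> nat \<Rightarrow> nat \<Rightarrow> 'a \<Rightarrow> 'a \<Rightarrow> 'a"
    and B :: "nat \<Rightarrow> nat \<Rightarrow> 'a set"
    and \<mu> :: 'a
    and \<eta> :: "'k \<Rightarrow> 'a"
  assumes "free_pointed_multiplicative_sigma_dg_operad scale Op d act one circ B \<mu> \<eta>"
    and "circ 2 0 0 0 1 \<mu> (\<eta> 1) = one"
    and "circ 2 0 0 0 2 \<mu> (\<eta> 1) = one"
  shows "chain_complex_algebra scale Op d (odot circ \<mu>) (\<eta> 1) \<and>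
         bicomplex_algebra scale Op d (odot circ \<mu>) (\<eta> 1) (-1) (boundary scale circ (\<eta> 1)) \<and>
         bicomplex_algebra scale Op d (odot circ \<mu>) (\<eta> 1) 1 (coboundary scale circ \<mu>)"


proof -
  interpret unital_multiplicative_operad scale Op d act one circ B \<mu> \<eta>
    using assms by (intro unital_multiplicative_operad.intro unital_multiplicative_operad_axioms.intro)
  show ?thesis
    using chain_complex_algebra_odot bicomplex_algebra_boundary bicomplex_algebra_coboundary by blast
qed

end
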